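(* Let $p,q\in\mathbb{R}$ and consider the equation $y^3+py+q=0$ in the real unknown $y$. When $p<0$, set $\xi=\frac{3q}{2p}\sqrt{-\frac{3}{p}}$. Case 1: $p=0$. There is a unique real solution $\alpha=-\sqrt[3]{q}$. Case 2: $p>0$. There is a unique real solution $$\alpha=\frac{q}{p\left(-\frac23-MY\left(\frac{2}{27}+\frac{q^2}{2p^3}\right)\right)}.$$ Case 3: $p<0$ and $|\xi|>1$. There is a unique real solution, with the two expressions $$\alpha=\frac{\xi}{|\xi|}\sqrt{-\frac p3}\left(3\,MY\left(\frac{1+|\xi|}{27}\right)+1\right)=\frac{q}{p\,MY\left(-\frac{q^2}{2p^3}\right)}.$$ Case 4: $p<0$ and $-1\le\xi\le1$. There are three real solutions (counted with multiplicity), namely $$\alpha=\sqrt{-\frac p3}\left(3\,MY\left(\frac{1+\xi}{27}\right)+1\right),$$ $$\beta=3\sqrt{-\frac p3}\left(MY\left(\frac{1-\xi}{27}\right)-MY\left(\frac{1+\xi}{27}\right)\right),$$ $$\gamma=-\sqrt{-\frac p3}\left(3\,MY\left(\frac{1-\xi}{27}\right)+1\right),$$ and $\gamma\le\beta\le\alpha$. If moreover $q\ne0$, the three solutions are also given by $$\alpha'=\frac{q}{p\,MY\left(-\frac{q^2}{2p^3}\right)},$$ $$\beta'=\frac{q}{p\left(MY\left(\frac{2}{27}+\frac{q^2}{2p^3}\right)-MY\left(-\frac{q^2}{2p^3}\right)-\frac13\right)},$$ $$\gamma'=\frac{-q}{p\left(\frac23+MY\left(\frac{2}{27}+\frac{q^2}{2p^3}\right)\right)},$$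 where $\alpha'=\alpha$, $\beta'=\gamma$, $\gamma'=\beta$ if $q<0$, and $\alpha'=\gamma$, $\beta'=\alpha$, $\gamma'=\beta$ if $q>0$.
   Context: The function $MY:[0,+\infty)\to[0,+\infty)$ is the inverse of the strictly increasing continuous bijection $[0,+\infty)\to[0,+\infty)$, $z\mapsto \frac{z^3+z^2}{2}$; that is, for $x\ge 0$, $MY(x)$ is the unique real $z\ge 0$ with $\frac{z^3+z^2}{2}=x$. $\sqrt[3]{\cdot}$ denotes the real cube root. *)

theory Defs
  imports Complex_Main "HOL-Computational_Algebra.Polynomial"
begin

text \<open>As the inverse on \<open>{0..}\<close>, \<open>MY\<close> is meaningful only at arguments \<open>x \<ge> 0\<close>.\<close>

definition MY :: "real \<Rightarrow> real" where
  "MY = the_inv_into {0..} (\<lambda>z. (z ^ 3 + z ^ 2) / 2)"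

end

theory Submission
  imports Defs
begin

text \<open>
  Substituting \<open>y = q / (p u)\<close> turns the cubic into \<open>u\<^sup>3 + u\<^sup>2 = - q\<^sup>2 / p\<^sup>3\<close>, and
  \<open>u = - 2/3 - v\<close> turns this into \<open>v\<^sup>3 + v\<^sup>2 = 4/27 + q\<^sup>2 / p\<^sup>3\<close>.  For \<open>p < 0\<close> put \<open>s = sqrt (- p / 3)\<close>;
  then \<open>p = - 3 s\<^sup>2\<close>, \<open>q = - 2 s\<^sup>3 \<xi>\<close>, and \<open>y = \<plusminus> s (3 z + 1)\<close> gives \<open>(z\<^sup>3 + z\<^sup>2) / 2 = (1 \<plusminus> \<xi>) / 27\<close>.
  If \<open>\<bar>\<xi>\<bar> \<le> 1\<close>, both signs give a root and the third root is minus their sum.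
\<close>

section \<open>The inverse function \<open>MY\<close>: characterisation and monotonicity\<close>

lemma MY_fun_strict_mono:
  fixes w z :: real
  assumes "0 \<le> w" "w < z"
  shows "(w ^ 3 + w ^ 2) / 2 < (z ^ 3 + z ^ 2) / 2"
  using assms by (intro divide_strict_right_mono add_strict_mono power_strict_mono) auto

lemma MY_fun_inj: "inj_on (\<lambda>z::real. (z ^ 3 + z ^ 2) / 2) {0..}"
  using MY_fun_strict_mono by (intro linorder_inj_onI) (auto simp: less_imp_neq)

lemma MY_eqI:
  assumes "0 \<le> z" "(z ^ 3 + z ^ 2) / 2 = x"
  shows "MY x = z"
  unfolding MY_def using assms by (intro the_inv_into_f_eq MY_fun_inj) auto

lemma MY_works:
  assumes "0 \<le> x"
  shows "0 \<le> MY x" "(MY x ^ 3 + MY x ^ 2) / 2 = x"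
proof -
  \<comment> \<open>The endpoint \<open>x + 1\<close> is large enough for the intermediate value
    theorem: the expansion of the right-hand side has nonnegative terms, among them
    \<open>5 * x / 2\<close>.\<close>
  have "x \<le> ((x + 1) ^ 3 + (x + 1) ^ 2) / 2"
    using assms by (simp add: power2_eq_square power3_eq_cube algebra_simps)
  then obtain z where "0 \<le> z" "(z ^ 3 + z ^ 2) / 2 = x"
    using IVT'[of "\<lambda>z. (z ^ 3 + z ^ 2) / 2" 0 x "x + 1"] assms
    by (fastforce intro: continuous_intros)
  with MY_eqI show "0 \<le> MY x" "(MY x ^ 3 + MY x ^ 2) / 2 = x" by auto
qed

lemma MY_strict_mono:
  assumes "0 \<le> x" "x < y"
  shows "MY x < MY y"
proof (rule ccontr)
  assume "\<not> MY x < MY y"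
  then have "MY y \<le> MY x" by simp
  with MY_fun_strict_mono[of "MY y" "MY x"] MY_works[of x] MY_works[of y] assms
  show False by (cases "MY y = MY x") auto
qed

lemma MY_mono:
  assumes "0 \<le> x" "x \<le> y"
  shows "MY x \<le> MY y"
  using MY_strict_mono[of x y] assms by (cases "x = y") auto

text \<open>The borderline between one root and three: the arguments \<open>(1 + \<xi>) / 27\<close>
  and \<open>(1 - \<xi>) / 27\<close> both lie between \<open>0\<close> and \<open>2/27\<close>
  exactly when \<open>\<bar>\<xi>\<bar> \<le> 1\<close>.\<close>

lemma MY_2_27: "MY (2/27) = 1/3"
  by (rule MY_eqI) (simp_all add: power2_eq_square power3_eq_cube)

section \<open>Passing between roots and values of \<open>MY\<close>\<close>

text \<open>Over the common denominator \<open>(p * u) ^ 3\<close> the numerator is \<open>q\<close>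
  times the equation for \<open>u\<close>; keeping the factor \<open>q\<close> covers
  \<open>q = 0\<close> too.\<close>

lemma reciprocal_root:
  fixes p q u :: real
  assumes "p \<noteq> 0" "u \<noteq> 0" "u ^ 3 + u ^ 2 = - (q ^ 2 / p ^ 3)"
  shows "(q / (p * u)) ^ 3 + p * (q / (p * u)) + q = 0"
proof -
  have "p ^ 3 * (u ^ 3 + u ^ 2) = - (q ^ 2)"
    using assms by simp
  then have "q * (q ^ 2 + p ^ 3 * (u ^ 3 + u ^ 2)) = 0" by simp
  moreover have "(q / (p * u)) ^ 3 + p * (q / (p * u)) + q
      = q * (q ^ 2 + p ^ 3 * (u ^ 3 + u ^ 2)) / (p * u) ^ 3"
    using assms(1,2) by (simp add: field_simps power2_eq_square power3_eq_cube)
  ultimately show ?thesis by simp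
qed

text \<open>Shows that the quotient occurring in the arguments of \<open>MY\<close> depends on a
  root \<open>y\<close> only through \<open>y ^ 2 / p\<close>, so that \<open>MY\<close> can be
  evaluated from a known root.\<close>

lemma square_quotient_of_root:
  fixes p q y :: real
  assumes "p \<noteq> 0" "y ^ 3 + p * y + q = 0"
  shows "q ^ 2 / p ^ 3 = (y ^ 2 / p) * (y ^ 2 / p + 1) ^ 2"
proof -
  have q: "q = - y * (y ^ 2 + p)"
    using assms(2) by (simp add: power2_eq_square power3_eq_cube algebra_simps)
  show ?thesis
    unfolding q using assms(1) by (simp add: field_simps power2_eq_square power3_eq_cube)
qed

text \<open>For \<open>z = - 1 - r\<close> with \<open>r = y ^ 2 / p\<close>,
  \<open>z ^ 2 * (z + 1) = - r * (r + 1) ^ 2\<close>; the bound on \<open>r\<close> is the condition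
  \<open>0 \<le> z\<close>.\<close>

lemma MY_of_outer_root:
  fixes p q y :: real
  assumes "p \<noteq> 0" "y ^ 3 + p * y + q = 0" "y ^ 2 / p \<le> - 1"
  shows "MY (- (q ^ 2 / (2 * p ^ 3))) = - 1 - y ^ 2 / p"
proof (rule MY_eqI)
  define r where "r = y ^ 2 / p"
  have "q ^ 2 / (2 * p ^ 3) = r * (r + 1) ^ 2 / 2"
    using square_quotient_of_root[OF assms(1,2)] by (simp add: r_def field_simps)
  then show "((- 1 - y ^ 2 / p) ^ 3 + (- 1 - y ^ 2 / p) ^ 2) / 2 = - (q ^ 2 / (2 * p ^ 3))"
    unfolding r_def[symmetric]
    by (simp only:) (simp add: power2_eq_square power3_eq_cube field_simps)
qed (use assms in simp)

text \<open>For \<open>z = 1/3 + r\<close> with \<open>r = y ^ 2 / p\<close>,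
  \<open>z ^ 3 + z ^ 2 = 4/27 + r * (r + 1) ^ 2\<close>; again the bound on \<open>r\<close> is
  \<open>0 \<le> z\<close>.\<close>

lemma MY_of_inner_root:
  fixes p q y :: real
  assumes "p \<noteq> 0" "y ^ 3 + p * y + q = 0" "- 1/3 \<le> y ^ 2 / p"
  shows "MY (2/27 + q ^ 2 / (2 * p ^ 3)) = 1/3 + y ^ 2 / p"
proof (rule MY_eqI)
  define r where "r = y ^ 2 / p"
  have "q ^ 2 / (2 * p ^ 3) = r * (r + 1) ^ 2 / 2"
    using square_quotient_of_root[OF assms(1,2)] by (simp add: r_def field_simps)
  then show "((1/3 + y ^ 2 / p) ^ 3 + (1/3 + y ^ 2 / p) ^ 2) / 2 = 2/27 + q ^ 2 / (2 * p ^ 3)"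
    unfolding r_def[symmetric]
    by (simp only:) (simp add: power2_eq_square power3_eq_cube field_simps)
qed (use assms in simp)

section \<open>Uniqueness of the root, and positive \<open>p\<close>\<close>

text \<open>Dividing the cubic by \<open>y - \<alpha>\<close> leaves a quadratic in \<open>y\<close>
  with discriminant \<open>- (3 * \<alpha> ^ 2 + 4 * p)\<close>, hence without real zeros.\<close>

lemma cubic_unique_root_of_outer:
  fixes p q \<alpha> :: real
  assumes "\<alpha> ^ 3 + p * \<alpha> + q = 0" "3 * \<alpha> ^ 2 + 4 * p > 0"
  shows "y ^ 3 + p * y + q = 0 \<longleftrightarrow> y = \<alpha>"
proof -
  have "y ^ 3 + p * y + q = (y - \<alpha>) * (y ^ 2 + y * \<alpha> + \<alpha> ^ 2 + p)"
    using assms(1) by (simp add: power2_eq_square power3_eq_cube algebra_simps)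
  moreover have "4 * (y ^ 2 + y * \<alpha> + \<alpha> ^ 2 + p) = (2 * y + \<alpha>) ^ 2 + (3 * \<alpha> ^ 2 + 4 * p)"
    by (simp add: power2_eq_square algebra_simps)
  then have "4 * (y ^ 2 + y * \<alpha> + \<alpha> ^ 2 + p) > 0"
    using assms(2) zero_le_power2[of "2 * y + \<alpha>"] by linarith
  then have "y ^ 2 + y * \<alpha> + \<alpha> ^ 2 + p \<noteq> 0" by auto
  ultimately show ?thesis by simp
qed

lemma cubic_pos_unique_root:
  fixes p q :: real
  assumes "p > 0"
  shows "y ^ 3 + p * y + q = 0 \<longleftrightarrow> y = q / (p * (- (2/3) - MY (2/27 + q ^ 2 / (2 * p ^ 3))))"
    (is "_ \<longleftrightarrow> y = ?\<alpha>")
proof -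
  define v where "v = MY (2/27 + q ^ 2 / (2 * p ^ 3))"
  have "0 \<le> 2/27 + q ^ 2 / (2 * p ^ 3)"
    using assms by (intro add_nonneg_nonneg) auto
  then have v: "v \<ge> 0" "(v ^ 3 + v ^ 2) / 2 = 2/27 + q ^ 2 / (2 * p ^ 3)"
    unfolding v_def by (rule MY_works)+
  have "q ^ 2 / p ^ 3 = v ^ 3 + v ^ 2 - 4/27"
    using v(2) by (simp add: field_simps)
  \<comment> \<open>The map \<open>v \<mapsto> - 2/3 - v\<close> belongs to the point reflection of
    the graph of \<open>v ^ 3 + v ^ 2\<close> in its inflection point \<open>(- 1/3, 2/27)\<close>,
    which sends a value \<open>t\<close> to \<open>4/27 - t\<close>.\<close>
  then have "(- (2/3) - v) ^ 3 + (- (2/3) - v) ^ 2 = - (q ^ 2 / p ^ 3)"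
    by (simp only:) (simp add: power2_eq_square power3_eq_cube field_simps)
  then have "?\<alpha> ^ 3 + p * ?\<alpha> + q = 0"
    using reciprocal_root[of p "- (2/3) - v" q] assms v(1) by (simp add: v_def)
  moreover have "3 * ?\<alpha> ^ 2 + 4 * p > 0"
    using assms by (intro add_nonneg_pos) auto
  ultimately show ?thesis
    by (rule cubic_unique_root_of_outer)
qed

section \<open>Negative \<open>p\<close>: scaling, and the case of a single root\<close>

text \<open>The critical points of the cubic are \<open>s\<close> and \<open>- s\<close>, with
  values \<open>- 2 * s ^ 3 * (1 + \<xi>)\<close> and \<open>2 * s ^ 3 * (1 - \<xi>)\<close>; thus
  \<open>\<xi>\<close> decides how many real roots there are.\<close>

lemma neg_cubic_scaling:
  fixes p q :: real
  assumes "p < 0"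
  defines "s \<equiv> sqrt (- (p / 3))" and "\<xi> \<equiv> 3 * q / (2 * p) * sqrt (- (3 / p))"
  shows "s > 0" "p = - 3 * s ^ 2" "q = - 2 * s ^ 3 * \<xi>"
proof -
  show "s > 0" using assms by (simp add: s_def)
  show p: "p = - 3 * s ^ 2" using assms by (simp add: s_def)
  have "sqrt (- (3 / p)) = sqrt (inverse (- (p / 3)))" by simp
  then have "sqrt (- (3 / p)) = 1 / s"
    by (simp only: real_sqrt_inverse s_def) (simp add: inverse_eq_divide)
  then have "\<xi> = 3 * q / (2 * (- 3 * s ^ 2)) * (1 / s)"
    unfolding \<xi>_def p[symmetric] by simp
  then show "q = - 2 * s ^ 3 * \<xi>"
    using \<open>s > 0\<close> by (simp add: field_simps power2_eq_square power3_eq_cube)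
qed

text \<open>The sign \<open>\<sigma>\<close> treats both substitutions at once. The linear terms
  cancel: \<open>(3 * z + 1) ^ 3 - 3 * (3 * z + 1) = 27 * (z ^ 3 + z ^ 2) - 2\<close>.\<close>

lemma scaled_root:
  fixes s \<xi> \<sigma> :: real
  assumes "0 \<le> 1 + \<sigma> * \<xi>" "\<sigma> * \<sigma> = 1"
  defines "\<alpha> \<equiv> \<sigma> * s * (3 * MY ((1 + \<sigma> * \<xi>) / 27) + 1)"
  shows "\<alpha> ^ 3 + (- 3 * s ^ 2) * \<alpha> + (- 2 * s ^ 3 * \<xi>) = 0"
proof -
  define z where "z = MY ((1 + \<sigma> * \<xi>) / 27)"
  have "(z ^ 3 + z ^ 2) / 2 = (1 + \<sigma> * \<xi>) / 27"
    unfolding z_def using assms(1) by (intro MY_works) simp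
  then have z: "27 * (z ^ 3 + z ^ 2) = 2 + 2 * (\<sigma> * \<xi>)" by simp
  have \<sigma>: "\<sigma> ^ 3 = \<sigma>" using assms(2) by (simp add: power3_eq_cube)
  have "\<alpha> ^ 3 + (- 3 * s ^ 2) * \<alpha> = \<sigma> ^ 3 * s ^ 3 * (3 * z + 1) ^ 3 - 3 * s ^ 3 * \<sigma> * (3 * z + 1)"
    unfolding \<alpha>_def z_def[symmetric] by (simp add: power2_eq_square power3_eq_cube algebra_simps)
  also have "\<dots> = \<sigma> * s ^ 3 * (27 * (z ^ 3 + z ^ 2) - 2)"
    unfolding \<sigma> by (simp add: power2_eq_square power3_eq_cube algebra_simps)
  also have "\<dots> = 2 * s ^ 3 * (\<sigma> * \<sigma>) * \<xi>"
    unfolding z by (simp add: algebra_simps)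
  finally show ?thesis using assms(2) by simp
qed

lemma neg_cubic_unique_root:
  fixes p q :: real
  assumes "p < 0"
  defines "\<xi> \<equiv> 3 * q / (2 * p) * sqrt (- (3 / p))"
  assumes "\<bar>\<xi>\<bar> > 1"
  defines "\<alpha> \<equiv> \<xi> / \<bar>\<xi>\<bar> * sqrt (- (p / 3)) * (3 * MY ((1 + \<bar>\<xi>\<bar>) / 27) + 1)"
  shows "y ^ 3 + p * y + q = 0 \<longleftrightarrow> y = \<alpha>"
    and "\<alpha> = q / (p * MY (- (q ^ 2 / (2 * p ^ 3))))"
proof -
  define s where "s = sqrt (- (p / 3))"
  note sc = neg_cubic_scaling(1,2)[OF assms(1), folded s_def]
    neg_cubic_scaling(3)[OF assms(1), of q, folded \<xi>_def s_def]
  define \<sigma> where "\<sigma> = \<xi> / \<bar>\<xi>\<bar>"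
  have \<sigma>: "\<sigma> * \<sigma> = 1" "\<sigma> * \<xi> = \<bar>\<xi>\<bar>"
    using assms(3) by (auto simp: \<sigma>_def abs_if field_simps)
  define z where "z = MY ((1 + \<bar>\<xi>\<bar>) / 27)"
  have \<alpha>: "\<alpha> = \<sigma> * s * (3 * z + 1)" by (simp add: \<alpha>_def \<sigma>_def s_def z_def)
  have root: "\<alpha> ^ 3 + p * \<alpha> + q = 0"
    using scaled_root[of \<sigma> \<xi> s] \<sigma> sc by (simp add: \<alpha> z_def)
  \<comment> \<open>This is where \<open>\<bar>\<xi>\<bar> > 1\<close> enters: it gives
    \<open>3 * z + 1 > 2\<close>, so \<open>\<alpha> ^ 2 > 4 * s ^ 2\<close>, which is the criterion
    for uniqueness because \<open>p = - 3 * s ^ 2\<close>.\<close>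
  have "z > 1/3"
    using MY_strict_mono[of "2/27" "(1 + \<bar>\<xi>\<bar>) / 27"] assms(3) by (simp add: MY_2_27 z_def)
  then have "(3 * z + 1) ^ 2 > 2 ^ 2"
    by (intro power_strict_mono) auto
  moreover have "\<alpha> ^ 2 = s ^ 2 * (3 * z + 1) ^ 2"
    using \<sigma>(1) by (simp add: \<alpha> power_mult_distrib power2_eq_square[of \<sigma>])
  ultimately have "\<alpha> ^ 2 > s ^ 2 * 4"
    using sc(1) by simp
  then have "3 * \<alpha> ^ 2 + 4 * p > 0"
    using sc(2) by linarith
  then show uniq: "y ^ 3 + p * y + q = 0 \<longleftrightarrow> y = \<alpha>" for y
    using cubic_unique_root_of_outer[OF root] by blast
  \<comment> \<open>The reciprocal expression is only shown to be a root; uniqueness then identifies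
    it with \<open>\<alpha>\<close>.\<close>
  define w where "w = MY (- (q ^ 2 / (2 * p ^ 3)))"
  have q: "q \<noteq> 0" using sc(1,3) assms(3) by auto
  have neg: "q ^ 2 / (2 * p ^ 3) < 0"
    using assms(1) q by (intro divide_pos_neg) (auto simp: power_less_zero_eq)
  then have w: "w \<ge> 0" "(w ^ 3 + w ^ 2) / 2 = - (q ^ 2 / (2 * p ^ 3))"
    unfolding w_def by (intro MY_works; simp)+
  with neg have "w \<noteq> 0" by auto
  moreover have "w ^ 3 + w ^ 2 = - (q ^ 2 / p ^ 3)"
    using w(2) by (simp add: field_simps)
  ultimately have "(q / (p * w)) ^ 3 + p * (q / (p * w)) + q = 0"
    using assms(1) by (intro reciprocal_root) auto
  with uniq have "q / (p * w) = \<alpha>" by blast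
  then show "\<alpha> = q / (p * MY (- (q ^ 2 / (2 * p ^ 3))))"
    by (simp only: w_def)
qed

section \<open>Negative \<open>p\<close>: three real roots\<close>

text \<open>Subtracting the two root equations and cancelling \<open>\<alpha> - \<gamma>\<close>
  determines \<open>p\<close>, and then either equation determines \<open>q\<close>. Nothing
  prevents \<open>\<beta>\<close> from coinciding with another root.\<close>

lemma cubic_coeffs_of_two_roots:
  fixes p q \<alpha> \<gamma> :: real
  assumes "\<alpha> ^ 3 + p * \<alpha> + q = 0" "\<gamma> ^ 3 + p * \<gamma> + q = 0" "\<alpha> \<noteq> \<gamma>" "\<beta> = - \<alpha> - \<gamma>"
  shows "p = \<alpha> * \<beta> + \<alpha> * \<gamma> + \<beta> * \<gamma>" "q = - (\<alpha> * \<beta> * \<gamma>)"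
proof -
  have "(\<alpha> - \<gamma>) * (\<alpha> ^ 2 + \<alpha> * \<gamma> + \<gamma> ^ 2 + p) = 0"
    using assms(1,2) by (simp add: power2_eq_square power3_eq_cube algebra_simps)
  then have p: "p = - (\<alpha> ^ 2 + \<alpha> * \<gamma> + \<gamma> ^ 2)" using assms(3) by auto
  then show "p = \<alpha> * \<beta> + \<alpha> * \<gamma> + \<beta> * \<gamma>"
    unfolding p assms(4) by (simp add: power2_eq_square algebra_simps)
  have "q = - (\<alpha> ^ 3) - p * \<alpha>" using assms(1) by simp
  then show "q = - (\<alpha> * \<beta> * \<gamma>)"
    unfolding p assms(4) by (simp add: power2_eq_square power3_eq_cube algebra_simps)
qed

text \<open>Vieta's relations amount to a factorisation into linear factors, which yields the roots
  with multiplicity.\<close>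

lemma proots_cubic:
  fixes \<alpha> \<beta> \<gamma> :: real
  assumes "\<alpha> + \<beta> + \<gamma> = 0" "p = \<alpha> * \<beta> + \<alpha> * \<gamma> + \<beta> * \<gamma>" "q = - (\<alpha> * \<beta> * \<gamma>)"
  shows "proots [:q, p, 0, 1:] = {#\<alpha>, \<beta>, \<gamma>#}"
proof -
  have "\<gamma> = - \<alpha> - \<beta>" using assms(1) by simp
  then have "[:q, p, 0, 1:] = [:- \<alpha>, 1:] * ([:- \<beta>, 1:] * [:- \<gamma>, 1:])"
    using assms(2,3) by (simp add: algebra_simps)
  moreover have "proots ([:- \<alpha>, 1:] * ([:- \<beta>, 1:] * [:- \<gamma>, 1:])) = {#\<alpha>, \<beta>, \<gamma>#}"
    by (subst proots_mult, simp, simp)+ (simp add: proots_linear_factor)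
  ultimately show ?thesis by simp
qed

text \<open>\<open>\<alpha>\<close> is an outer root because
  \<open>\<alpha> ^ 2 + p = \<beta> * \<gamma>\<close>, and \<open>\<beta>\<close> an inner one.
  Each denominator then becomes, up to sign, the product of two roots, and
  \<open>q = - (\<alpha> * \<beta> * \<gamma>)\<close> leaves the third. Which extreme root plays
  \<open>\<alpha>\<close> is left open, to serve both signs of \<open>q\<close>.\<close>

lemma reciprocal_formulas:
  fixes p q \<alpha> \<beta> \<gamma> :: real
  assumes "p < 0" "q \<noteq> 0" "\<alpha> + \<beta> + \<gamma> = 0"
    and pq: "p = \<alpha> * \<beta> + \<alpha> * \<gamma> + \<beta> * \<gamma>" "q = - (\<alpha> * \<beta> * \<gamma>)"
    and outer: "0 \<le> \<beta> * \<gamma>" and inner: "3 * \<beta> ^ 2 \<le> - p"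
  shows "q / (p * MY (- (q ^ 2 / (2 * p ^ 3)))) = \<alpha>"
    and "q / (p * (MY (2/27 + q ^ 2 / (2 * p ^ 3)) - MY (- (q ^ 2 / (2 * p ^ 3))) - 1/3)) = \<gamma>"
    and "- q / (p * (2/3 + MY (2/27 + q ^ 2 / (2 * p ^ 3)))) = \<beta>"
proof -
  have \<gamma>: "\<gamma> = - \<alpha> - \<beta>" and nz: "\<alpha> \<noteq> 0" "\<beta> \<noteq> 0" "\<gamma> \<noteq> 0"
    using assms by auto
  have roots: "\<alpha> ^ 3 + p * \<alpha> + q = 0" "\<beta> ^ 3 + p * \<beta> + q = 0"
    unfolding pq \<gamma> by (simp_all add: power2_eq_square power3_eq_cube algebra_simps)
  have \<alpha>p: "\<alpha> ^ 2 + p = \<beta> * \<gamma>" and \<beta>p: "\<beta> ^ 2 + p = \<alpha> * \<gamma>"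
    and \<alpha>\<beta>p: "\<alpha> ^ 2 + \<beta> ^ 2 + p = - (\<alpha> * \<beta>)"
    unfolding pq(1) \<gamma> by (simp_all add: power2_eq_square algebra_simps)
  have "\<alpha> ^ 2 / p \<le> - 1"
    using assms(1) \<alpha>p outer by (simp add: divide_le_eq)
  then have w: "MY (- (q ^ 2 / (2 * p ^ 3))) = - 1 - \<alpha> ^ 2 / p"
    using assms(1) roots(1) by (intro MY_of_outer_root) auto
  have "- 1/3 \<le> \<beta> ^ 2 / p"
    using assms(1) inner by (simp add: le_divide_eq)
  then have v: "MY (2/27 + q ^ 2 / (2 * p ^ 3)) = 1/3 + \<beta> ^ 2 / p"
    using assms(1) roots(2) by (intro MY_of_inner_root) auto
  have "p * MY (- (q ^ 2 / (2 * p ^ 3))) = - (\<beta> * \<gamma>)"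
    unfolding w \<alpha>p[symmetric] using assms(1) by (simp add: field_simps)
  then show "q / (p * MY (- (q ^ 2 / (2 * p ^ 3)))) = \<alpha>"
    using nz pq(2) by simp
  have "p * (2/3 + MY (2/27 + q ^ 2 / (2 * p ^ 3))) = \<alpha> * \<gamma>"
    unfolding v \<beta>p[symmetric] using assms(1) by (simp add: field_simps)
  then show "- q / (p * (2/3 + MY (2/27 + q ^ 2 / (2 * p ^ 3)))) = \<beta>"
    using nz pq(2) by simp
  have "p * (MY (2/27 + q ^ 2 / (2 * p ^ 3)) - MY (- (q ^ 2 / (2 * p ^ 3))) - 1/3) = - (\<alpha> * \<beta>)"
    unfolding v w \<alpha>\<beta>p[symmetric] using assms(1) by (simp add: field_simps)
  then show "q / (p * (MY (2/27 + q ^ 2 / (2 * p ^ 3)) - MY (- (q ^ 2 / (2 * p ^ 3))) - 1/3)) = \<gamma>"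
    using nz pq(2) by simp
qed

lemma neg_cubic_three_roots:
  fixes p q :: real
  assumes "p < 0"
  defines "\<xi> \<equiv> 3 * q / (2 * p) * sqrt (- (3 / p))"
  assumes "- 1 \<le> \<xi>" "\<xi> \<le> 1"
  defines "\<alpha> \<equiv> sqrt (- (p / 3)) * (3 * MY ((1 + \<xi>) / 27) + 1)"
    and "\<beta> \<equiv> 3 * sqrt (- (p / 3)) * (MY ((1 - \<xi>) / 27) - MY ((1 + \<xi>) / 27))"
    and "\<gamma> \<equiv> - (sqrt (- (p / 3)) * (3 * MY ((1 - \<xi>) / 27) + 1))"
  shows "\<alpha> + \<beta> + \<gamma> = 0" "p = \<alpha> * \<beta> + \<alpha> * \<gamma> + \<beta> * \<gamma>" "q = - (\<alpha> * \<beta> * \<gamma>)"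
    and "\<gamma> \<le> \<beta>" "\<beta> \<le> \<alpha>" "\<gamma> < 0" "0 < \<alpha>" "3 * \<beta> ^ 2 \<le> - p"
proof -
  define s where "s = sqrt (- (p / 3))"
  note sc = neg_cubic_scaling(1,2)[OF assms(1), folded s_def]
    neg_cubic_scaling(3)[OF assms(1), of q, folded \<xi>_def s_def]
  define a where "a = MY ((1 + \<xi>) / 27)"
  define b where "b = MY ((1 - \<xi>) / 27)"
  note defs = \<alpha>_def \<beta>_def \<gamma>_def
  note defs = defs[folded s_def a_def b_def]
  have ab: "0 \<le> a" "0 \<le> b" "a \<le> 1/3" "b \<le> 1/3"
    using MY_works(1)[of "(1 + \<xi>) / 27"] MY_works(1)[of "(1 - \<xi>) / 27"]
      MY_mono[of "(1 + \<xi>) / 27" "2/27"] MY_mono[of "(1 - \<xi>) / 27" "2/27"] assms(3,4)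
    by (simp_all add: a_def b_def MY_2_27)
  show sum: "\<alpha> + \<beta> + \<gamma> = 0"
    by (simp add: defs algebra_simps)
  show "0 < \<alpha>" "\<gamma> < 0"
    using sc(1) ab by (simp_all add: defs zero_less_mult_iff)
  have "\<alpha> ^ 3 + p * \<alpha> + q = 0"
    using scaled_root[of 1 \<xi> s, folded sc(2,3)] assms(3) by (simp add: defs(1) a_def)
  moreover have "\<gamma> ^ 3 + p * \<gamma> + q = 0"
    using scaled_root[of "- 1" \<xi> s, folded sc(2,3)] assms(4) by (simp add: defs(3) b_def)
  \<comment> \<open>The strict signs separate \<open>\<alpha>\<close> from \<open>\<gamma>\<close>
    even for \<open>\<xi> = 1\<close> or \<open>\<xi> = - 1\<close>, where \<open>\<beta>\<close>
    merges with one of them.\<close>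
  moreover have "\<alpha> \<noteq> \<gamma>" "\<beta> = - \<alpha> - \<gamma>"
    using \<open>0 < \<alpha>\<close> \<open>\<gamma> < 0\<close> sum by auto
  ultimately show "p = \<alpha> * \<beta> + \<alpha> * \<gamma> + \<beta> * \<gamma>" "q = - (\<alpha> * \<beta> * \<gamma>)"
    by (rule cubic_coeffs_of_two_roots)+
  have \<beta>: "\<beta> = s * (3 * (b - a))" by (simp add: defs)
  \<comment> \<open>Since \<open>a\<close> and \<open>b\<close> lie in \<open>[0, 1/3]\<close>,
    \<open>3 * (b - a)\<close> lies between \<open>- 1\<close> and \<open>1\<close>, while
    \<open>3 * a + 1\<close> and \<open>3 * b + 1\<close> are at least \<open>1\<close>.\<close>
  have "s * (3 * (b - a)) \<le> s * (3 * a + 1)" "s * (- (3 * b + 1)) \<le> s * (3 * (b - a))"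
    using sc(1) ab by (intro mult_left_mono; simp)+
  then show "\<beta> \<le> \<alpha>" "\<gamma> \<le> \<beta>"
    by (simp_all only: \<beta> defs(1,3) mult_minus_right)
  have "\<bar>3 * (b - a)\<bar> \<le> 1" using ab by simp
  then have "(3 * (b - a)) ^ 2 \<le> 1" by (simp only: abs_square_le_1)
  then have "\<beta> ^ 2 \<le> s ^ 2"
    unfolding \<beta> power_mult_distrib[of s] by (simp add: mult_left_le)
  then show "3 * \<beta> ^ 2 \<le> - p" using sc(2) by simp
qed

text \<open>The product of the roots is \<open>- q\<close>, so the sign of \<open>q\<close> tells
  which extreme root has the other two on one side of zero; that root plays the outer one.\<close>

lemma neg_cubic_reciprocal_formulas:
  fixes p q :: real
  assumes "p < 0"
  defines "\<xi> \<equiv> 3 * q / (2 * p) * sqrt (- (3 / p))"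
  assumes "- 1 \<le> \<xi>" "\<xi> \<le> 1"
  defines "\<alpha> \<equiv> sqrt (- (p / 3)) * (3 * MY ((1 + \<xi>) / 27) + 1)"
    and "\<beta> \<equiv> 3 * sqrt (- (p / 3)) * (MY ((1 - \<xi>) / 27) - MY ((1 + \<xi>) / 27))"
    and "\<gamma> \<equiv> - (sqrt (- (p / 3)) * (3 * MY ((1 - \<xi>) / 27) + 1))"
  defines "\<alpha>' \<equiv> q / (p * MY (- (q ^ 2 / (2 * p ^ 3))))"
    and "\<beta>' \<equiv> q / (p * (MY (2/27 + q ^ 2 / (2 * p ^ 3)) - MY (- (q ^ 2 / (2 * p ^ 3))) - 1/3))"
    and "\<gamma>' \<equiv> - q / (p * (2/3 + MY (2/27 + q ^ 2 / (2 * p ^ 3))))"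
  shows "q < 0 \<Longrightarrow> \<alpha>' = \<alpha> \<and> \<beta>' = \<gamma> \<and> \<gamma>' = \<beta>"
    and "q > 0 \<Longrightarrow> \<alpha>' = \<gamma> \<and> \<beta>' = \<alpha> \<and> \<gamma>' = \<beta>"
proof -
  note r = neg_cubic_three_roots[OF assms(1), of q, folded \<xi>_def, OF assms(3,4),
      folded \<alpha>_def \<beta>_def \<gamma>_def]
  show "\<alpha>' = \<alpha> \<and> \<beta>' = \<gamma> \<and> \<gamma>' = \<beta>" if "q < 0"
  proof -
    have "0 < \<alpha> * (\<beta> * \<gamma>)" using that r(3) by (simp add: mult.assoc)
    then have nonneg: "0 \<le> \<beta> * \<gamma>" using r(7) zero_less_mult_pos less_imp_le by blast
    show ?thesis
      unfolding \<alpha>'_def \<beta>'_def \<gamma>'_def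
      by (intro conjI; rule reciprocal_formulas[OF assms(1) less_imp_neq[OF that] r(1-3) nonneg r(8)])
  qed
  show "\<alpha>' = \<gamma> \<and> \<beta>' = \<alpha> \<and> \<gamma>' = \<beta>" if "q > 0"
  proof -
    have "0 < - \<gamma> * (\<beta> * \<alpha>)" using that r(3) by (simp add: mult_ac)
    then have "0 < \<beta> * \<alpha>" by (rule zero_less_mult_pos) (use r(6) in simp)
    then have nonneg: "0 \<le> \<beta> * \<alpha>" by (rule less_imp_le)
    \<comment> \<open>For positive \<open>q\<close> the extreme roots exchange roles, and the
      symmetric relations carry over.\<close>
    have r': "\<gamma> + \<beta> + \<alpha> = 0" "p = \<gamma> * \<beta> + \<gamma> * \<alpha> + \<beta> * \<alpha>" "q = - (\<gamma> * \<beta> * \<alpha>)"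
      using r(1-3) by (simp_all only: ac_simps)
    show ?thesis
      unfolding \<alpha>'_def \<beta>'_def \<gamma>'_def
      by (intro conjI; rule reciprocal_formulas[OF assms(1) less_imp_neq[OF that, symmetric] r' nonneg r(8)])
  qed
qed

section \<open>Assembly of the four cases\<close>

theorem mainTheorem3:
  fixes p q :: real
  shows
    "(p = 0 \<longrightarrow>
        (\<forall>y::real. y ^ 3 + p * y + q = 0 \<longleftrightarrow> y = - root 3 q))
     \<and>
     (p > 0 \<longrightarrow>
        (\<forall>y::real. y ^ 3 + p * y + q = 0 \<longleftrightarrow>
           y = q / (p * (- (2/3) - MY (2/27 + q ^ 2 / (2 * p ^ 3))))))
     \<and>
     (p < 0 \<longrightarrow>
       (let \<xi> = 3 * q / (2 * p) * sqrt (- (3 / p)) in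
         (\<bar>\<xi>\<bar> > 1 \<longrightarrow>
           (let \<alpha> = \<xi> / \<bar>\<xi>\<bar> * sqrt (- (p / 3)) * (3 * MY ((1 + \<bar>\<xi>\<bar>) / 27) + 1) in
             (\<forall>y::real. y ^ 3 + p * y + q = 0 \<longleftrightarrow> y = \<alpha>) \<and>
             \<alpha> = q / (p * MY (- (q ^ 2 / (2 * p ^ 3))))))
         \<and>
         (- 1 \<le> \<xi> \<and> \<xi> \<le> 1 \<longrightarrow>
           (let \<alpha> = sqrt (- (p / 3)) * (3 * MY ((1 + \<xi>) / 27) + 1);
                \<beta> = 3 * sqrt (- (p / 3)) * (MY ((1 - \<xi>) / 27) - MY ((1 + \<xi>) / 27));
                \<gamma> = - (sqrt (- (p / 3)) * (3 * MY ((1 - \<xi>) / 27) + 1)) in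
             (\<forall>y::real. y ^ 3 + p * y + q = 0 \<longleftrightarrow> y = \<alpha> \<or> y = \<beta> \<or> y = \<gamma>) \<and>
             proots [:q, p, 0, 1:] = {#\<alpha>, \<beta>, \<gamma>#} \<and>
             \<gamma> \<le> \<beta> \<and> \<beta> \<le> \<alpha> \<and>
             (q \<noteq> 0 \<longrightarrow>
               (let \<alpha>' = q / (p * MY (- (q ^ 2 / (2 * p ^ 3))));
                    \<beta>' = q / (p * (MY (2/27 + q ^ 2 / (2 * p ^ 3))
                                   - MY (- (q ^ 2 / (2 * p ^ 3))) - 1/3));
                    \<gamma>' = - q / (p * (2/3 + MY (2/27 + q ^ 2 / (2 * p ^ 3)))) in
                 proots [:q, p, 0, 1:] = {#\<alpha>', \<beta>', \<gamma>'#} \<and>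
                 (q < 0 \<longrightarrow> \<alpha>' = \<alpha> \<and> \<beta>' = \<gamma> \<and> \<gamma>' = \<beta>) \<and>
                 (q > 0 \<longrightarrow> \<alpha>' = \<gamma> \<and> \<beta>' = \<alpha> \<and> \<gamma>' = \<beta>)))))))"
proof -
  have case1: "y ^ 3 + p * y + q = 0 \<longleftrightarrow> y = - root 3 q" if "p = 0" for y
  proof -
    have "y ^ 3 + p * y + q = 0 \<longleftrightarrow> (- y) ^ 3 = q" using that by auto
    also have "\<dots> \<longleftrightarrow> y = - root 3 q"
      using odd_real_root_power_cancel[of 3 "- y"] odd_real_root_pow[of 3 q] by auto
    finally show ?thesis .
  qed
  show ?thesis
    unfolding Let_def
  proof (intro conjI impI allI, goal_cases)
    case 1 then show ?case by (rule case1)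
  next
    case 2 then show ?case by (rule cubic_pos_unique_root)
  next
    case 3 then show ?case by (rule neg_cubic_unique_root)
  next
    case 4 then show ?case by (rule neg_cubic_unique_root)
  next
    case (5 y)
    \<comment> \<open>The solution set is read off from the multiset of roots.\<close>
    note r = neg_cubic_three_roots[OF 5(1) conjunct1[OF 5(2)] conjunct2[OF 5(2)]]
    let ?p = "[:q, p, 0, 1:]"
    have "y ^ 3 + p * y + q = 0 \<longleftrightarrow> poly ?p y = 0"
      by (simp add: power3_eq_cube algebra_simps)
    also have "\<dots> \<longleftrightarrow> y \<in># proots ?p"
      by (simp add: set_count_proots)
    finally show ?case
      unfolding proots_cubic[OF r(1-3)] by simp
  next
    case 6
    note bounds = 6(1) conjunct1[OF 6(2)] conjunct2[OF 6(2)]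
    show ?case
      by (rule proots_cubic[OF neg_cubic_three_roots(1-3)[OF bounds]])
  next
    case 7
    then show ?case by (elim conjE) (rule neg_cubic_three_roots(4))
  next
    case 8
    then show ?case by (elim conjE) (rule neg_cubic_three_roots(5))
  next
    case 9
    note bounds = 9(1) conjunct1[OF 9(2)] conjunct2[OF 9(2)]
    note proots = proots_cubic[OF neg_cubic_three_roots(1-3)[OF bounds]]
    note swap = neg_cubic_reciprocal_formulas[OF bounds]
    \<comment> \<open>For either sign of \<open>q\<close> the primed roots are a permutation of the
      unprimed ones, so the multiset is the same.\<close>
    from 9(3) consider "q < 0" | "q > 0" by linarith
    then show ?case
    proof cases
      case 1
      show ?thesis by (simp only: swap(1)[OF 1] proots add_mset_commute)
    next
      case 2
      show ?thesis by (simp only: swap(2)[OF 2] proots add_mset_commute)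
    qed
  qed (simp_all only: neg_cubic_reciprocal_formulas)
qed

end
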